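(* Let $\mathcal X$ be a separable Hilbert space, $a$ a bounded bilinear form on $\mathcal X$ with $\inf_{x\ne0}a(x,x)/\|x\|_{\mathcal X}^2>0$, $f\in\mathcal X^*$, $u\in\mathcal X$ with $a(u,v)=f(v)$ for all $v\in\mathcal X$. Let $(w_n)$ and $(v_n)$ be two Riesz bases of $\mathcal X$, each satisfying $C^{-1}\|x\|_{\mathcal X}^2\le\sum\lambda_n^2\le C\|x\|_{\mathcal X}^2$ for the coefficients $\lambda$ of $x$, and let $\mathcal X_\ell={\rm span}\{w_1,\dots,w_{N_\ell}\}={\rm span}\{v_1,\dots,v_{N_\ell}\}$ with $N_\ell<N_{\ell+1}$; let $u_\ell\in\mathcal X_\ell$ satisfy $a(u_\ell,v)=f(v)$ for all $v\in\mathcal X_\ell$. Let $M_{ij}:=a(v_j,w_i)$ and suppose that for some $\varepsilon>0$ there exists $M^\varepsilon$ with $\|M-M^\varepsilon\|_2\le\varepsilon$. If $M$ and $M^\varepsilon$ are elliptic (there is $C_{\rm ell}>0$ with $Mx\cdot x\ge C_{\rm ell}\|x\|_{\ell_2}^2$ and $M^\varepsilon x\cdot x\ge C_{\rm ell}\|x\|_{\ell_2}^2$ for all $x\in\ell_2$) and $M^\varepsilon\in\mathcal J$, then there is $C_{\rm qo}>0$ such that for all $\ell,N\in\mathbb N_0$ \[ \sum_{k=\ell}^{\ell+N}\Big(\|u_{k+1}-u_k\|_{\mathcal X}^2-C_{\rm qo}\varepsilon\|u-u_k\|_{\mathcal X}^2\Big)\le C_{\rm qo}\|u-u_\ell\|_{\mathcal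 X}^2 . \] $C_{\rm qo}$ depends only on $(w_n)$, $a$, $C_{\rm ell}$, $C$, the Jaffard class and $\mathcal X$.
   Context: $\|\cdot\|_2$ is the operator norm on $\ell_2$. $M^\varepsilon\in\mathcal J$ means there exist a metric $d$ on $\mathbb N$ with $\sup_i\sum_j\exp(-\delta d(i,j))<\infty$ for all $\delta>0$, and $\gamma>0$, such that for all $0<\gamma'<\gamma$ there is $C(\gamma')$ with $|M^\varepsilon_{ij}|\le C(\gamma')\exp(-\gamma'd(i,j))$. *)

theory Defs
  imports "HOL-Analysis.Analysis"
begin

definition l2 :: "(nat \<Rightarrow> real) \<Rightarrow> bool" where
  "l2 x \<longleftrightarrow> summable (\<lambda>n. (x n)^2)"

definition riesz_basis :: "real \<Rightarrow> (nat \<Rightarrow> 'a::real_normed_vector) \<Rightarrow> bool" where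
  "riesz_basis C w \<longleftrightarrow> C > 0 \<and>
     (\<forall>x. \<exists>!lam. l2 lam \<and> (\<lambda>n. lam n *\<^sub>R w n) sums x) \<and>
     (\<forall>lam x. l2 lam \<and> (\<lambda>n. lam n *\<^sub>R w n) sums x \<longrightarrow>
        (norm x)^2 / C \<le> (\<Sum>n. (lam n)^2) \<and> (\<Sum>n. (lam n)^2) \<le> C * (norm x)^2)"

definition mat_apply :: "(nat \<Rightarrow> nat \<Rightarrow> real) \<Rightarrow> (nat \<Rightarrow> real) \<Rightarrow> nat \<Rightarrow> real" where
  "mat_apply A x i = (\<Sum>j. A i j * x j)"

definition op_norm2_le :: "(nat \<Rightarrow> nat \<Rightarrow> real) \<Rightarrow> real \<Rightarrow> bool" where
  "op_norm2_le A e \<longleftrightarrow> (\<forall>x. l2 x \<longrightarrow>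
     (\<forall>i. summable (\<lambda>j. A i j * x j)) \<and> l2 (mat_apply A x) \<and>
     (\<Sum>i. (mat_apply A x i)^2) \<le> e^2 * (\<Sum>i. (x i)^2))"

definition elliptic :: "real \<Rightarrow> (nat \<Rightarrow> nat \<Rightarrow> real) \<Rightarrow> bool" where
  "elliptic c A \<longleftrightarrow> (\<forall>x. l2 x \<longrightarrow>
     (\<forall>i. summable (\<lambda>j. A i j * x j)) \<and> summable (\<lambda>i. mat_apply A x i * x i) \<and>
     (\<Sum>i. mat_apply A x i * x i) \<ge> c * (\<Sum>i. (x i)^2))"

definition jaffard_metric :: "(nat \<Rightarrow> nat \<Rightarrow> real) \<Rightarrow> bool" where
  "jaffard_metric d \<longleftrightarrow>
     (\<forall>i j. 0 \<le> d i j) \<and> (\<forall>i j. d i j = 0 \<longleftrightarrow> i = j) \<and> (\<forall>i j. d i j = d j i) \<and>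
     (\<forall>i j k. d i k \<le> d i j + d j k) \<and>
     (\<forall>\<delta>>0. \<exists>B. \<forall>i. summable (\<lambda>j. exp (- \<delta> * d i j)) \<and> (\<Sum>j. exp (- \<delta> * d i j)) \<le> B)"

definition jaffard_bound ::
  "(nat \<Rightarrow> nat \<Rightarrow> real) \<Rightarrow> real \<Rightarrow> (real \<Rightarrow> real) \<Rightarrow> (nat \<Rightarrow> nat \<Rightarrow> real) \<Rightarrow> bool" where
  "jaffard_bound d \<gamma> CJ A \<longleftrightarrow>
     (\<forall>\<gamma>'. 0 < \<gamma>' \<and> \<gamma>' < \<gamma> \<longrightarrow> (\<forall>i j. \<bar>A i j\<bar> \<le> CJ \<gamma>' * exp (- \<gamma>' * d i j)))"

end

theory Submission
  imports Defs
begin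

text \<open>
  Let \<open>A\<close> be the approximating Jaffard matrix. By the Combes-Thomas argument, the inverses of the
  finite sections of \<open>A\<close> have uniformly exponentially decaying entries. Hence \<open>A\<close> has an LU
  factorization: there are triangular matrices \<open>Z\<close> and \<open>Q\<close>, bounded on \<open>l2\<close> by the Schur test, such
  that \<open>U = Z A\<close> is unit upper triangular and has the inverse \<open>Q\<close>. All bounds depend only
  on the metric, the decay of \<open>A\<close> and the ellipticity constant.

  Let \<open>x\<close> and \<open>x\<^sub>k\<close> be the coefficients of \<open>u\<close> and \<open>u\<^sub>k\<close> with respect to \<open>v\<close>. If \<open>A\<close> were the
  Galerkin matrix itself, then \<open>U x\<^sub>k\<close> would be the truncation of \<open>U x\<close> to the first \<open>N\<^sub>k\<close> entries,
  so the increments \<open>U (x\<^sub>k\<^sub>+\<^sub>1 - x\<^sub>k)\<close> would be orthogonal and their squares would add up to a piece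
  of \<open>U (x - x\<^sub>l)\<close>. In general, Galerkin orthogonality makes the first \<open>N\<^sub>k\<close> entries of
  \<open>A (x - x\<^sub>k)\<close>, and so those of \<open>U (x - x\<^sub>k)\<close>, of size \<open>\<epsilon> \<parallel>x - x\<^sub>k\<parallel>\<close>, which produces the terms
  with \<open>\<epsilon>\<^sup>2 \<le> \<epsilon>\<close>. For \<open>\<epsilon> > 1\<close> the estimate is a consequence of Cea's lemma.
\<close>

subsection \<open>The Schur test and elliptic sections\<close>

text \<open>Cauchy-Schwarz, with \<open>\<bar>K i j\<bar>\<close> split into two square roots: the
  row bound absorbs one factor, and after swapping the sums the column bound absorbs the
  other.\<close>

lemma schur_test:
  fixes K :: "nat \<Rightarrow> nat \<Rightarrow> real"
  assumes row: "\<And>i. i < m \<Longrightarrow> (\<Sum>j<p. \<bar>K i j\<bar>) \<le> S"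
    and col: "\<And>j. j < p \<Longrightarrow> (\<Sum>i<m. \<bar>K i j\<bar>) \<le> S"
  shows "(\<Sum>i<m. (\<Sum>j<p. K i j * x j)\<^sup>2) \<le> S\<^sup>2 * (\<Sum>j<p. (x j)\<^sup>2)"
proof (cases "m = 0")
  case True
  then show ?thesis by (simp add: sum_nonneg)
next
  case False
  have S0: "0 \<le> S"
    by (rule order_trans[OF sum_nonneg row[of 0]]) (use False in auto)
  have "(\<Sum>i<m. (\<Sum>j<p. K i j * x j)\<^sup>2) \<le> (\<Sum>i<m. S * (\<Sum>j<p. \<bar>K i j\<bar> * (x j)\<^sup>2))"
  proof (rule sum_mono)
    fix i assume "i \<in> {..<m}"
    have "(\<Sum>j<p. K i j * x j)\<^sup>2 \<le> (\<Sum>j<p. \<bar>K i j\<bar> * \<bar>x j\<bar>)\<^sup>2"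
    proof (rule abs_le_square_iff[THEN iffD1])
      have "\<bar>\<Sum>j<p. K i j * x j\<bar> \<le> (\<Sum>j<p. \<bar>K i j\<bar> * \<bar>x j\<bar>)"
        by (simp add: sum_abs flip: abs_mult)
      then show "\<bar>\<Sum>j<p. K i j * x j\<bar> \<le> \<bar>\<Sum>j<p. \<bar>K i j\<bar> * \<bar>x j\<bar>\<bar>" by linarith
    qed
    also have "\<dots> = (\<Sum>j<p. sqrt \<bar>K i j\<bar> * (sqrt \<bar>K i j\<bar> * \<bar>x j\<bar>))\<^sup>2"
      by (simp flip: mult.assoc)
    also have "\<dots> \<le> (\<Sum>j<p. (sqrt \<bar>K i j\<bar>)\<^sup>2) * (\<Sum>j<p. (sqrt \<bar>K i j\<bar> * \<bar>x j\<bar>)\<^sup>2)"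
      by (rule Cauchy_Schwarz_ineq_sum)
    also have "\<dots> = (\<Sum>j<p. \<bar>K i j\<bar>) * (\<Sum>j<p. \<bar>K i j\<bar> * (x j)\<^sup>2)"
      by (simp add: power_mult_distrib)
    also have "\<dots> \<le> S * (\<Sum>j<p. \<bar>K i j\<bar> * (x j)\<^sup>2)"
      using row \<open>i \<in> {..<m}\<close> by (intro mult_right_mono sum_nonneg) auto
    finally show "(\<Sum>j<p. K i j * x j)\<^sup>2 \<le> S * (\<Sum>j<p. \<bar>K i j\<bar> * (x j)\<^sup>2)" .
  qed
  also have "\<dots> = S * (\<Sum>j<p. (\<Sum>i<m. \<bar>K i j\<bar>) * (x j)\<^sup>2)"
    unfolding sum_distrib_left[symmetric] sum_distrib_right by (subst sum.swap) simp
  also have "\<dots> \<le> S * (\<Sum>j<p. S * (x j)\<^sup>2)"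
    using col S0 by (intro mult_left_mono sum_mono mult_right_mono) auto
  finally show ?thesis
    by (simp add: sum_distrib_left power2_eq_square mult.assoc)
qed

text \<open>By the arithmetic-geometric mean inequality each term splits into a part in
  \<open>(x i)\<^sup>2\<close>, summed along rows, and a part in \<open>(x j)\<^sup>2\<close>,
  summed along columns.\<close>

lemma schur_test_quadratic_form:
  fixes K :: "nat \<Rightarrow> nat \<Rightarrow> real"
  assumes row: "\<And>i. i < m \<Longrightarrow> (\<Sum>j<m. \<bar>K i j\<bar>) \<le> S"
    and col: "\<And>j. j < m \<Longrightarrow> (\<Sum>i<m. \<bar>K i j\<bar>) \<le> S"
  shows "\<bar>\<Sum>i<m. \<Sum>j<m. x i * K i j * x j\<bar> \<le> S * (\<Sum>i<m. (x i)\<^sup>2)"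
proof -
  have "\<bar>\<Sum>i<m. \<Sum>j<m. x i * K i j * x j\<bar> \<le> (\<Sum>i<m. \<Sum>j<m. \<bar>x i * K i j * x j\<bar>)"
    by (rule order_trans[OF sum_abs sum_mono]) (rule sum_abs)
  also have "\<dots> \<le> (\<Sum>i<m. \<Sum>j<m. \<bar>K i j\<bar> * (x i)\<^sup>2 / 2 + \<bar>K i j\<bar> * (x j)\<^sup>2 / 2)"
  proof (intro sum_mono)
    fix i j
    have "2 * (\<bar>x i\<bar> * \<bar>x j\<bar>) \<le> (x i)\<^sup>2 + (x j)\<^sup>2"
      using sum_squares_bound[of "\<bar>x i\<bar>" "\<bar>x j\<bar>"] by (simp add: mult.assoc)
    then have "\<bar>K i j\<bar> * (2 * (\<bar>x i\<bar> * \<bar>x j\<bar>)) \<le> \<bar>K i j\<bar> * ((x i)\<^sup>2 + (x j)\<^sup>2)"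
      by (rule mult_left_mono) simp
    then show "\<bar>x i * K i j * x j\<bar> \<le> \<bar>K i j\<bar> * (x i)\<^sup>2 / 2 + \<bar>K i j\<bar> * (x j)\<^sup>2 / 2"
      by (simp add: abs_mult algebra_simps)
  qed
  also have "\<dots> = (\<Sum>i<m. (\<Sum>j<m. \<bar>K i j\<bar>) * (x i)\<^sup>2 / 2) + (\<Sum>j<m. (\<Sum>i<m. \<bar>K i j\<bar>) * (x j)\<^sup>2 / 2)"
    unfolding sum.distrib sum_distrib_right sum_divide_distrib
    by (subst (2) sum.swap) simp
  also have "\<dots> \<le> (\<Sum>i<m. S * (x i)\<^sup>2 / 2) + (\<Sum>j<m. S * (x j)\<^sup>2 / 2)"
    using row col by (intro add_mono sum_mono divide_right_mono mult_right_mono) auto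
  also have "\<dots> = S * (\<Sum>i<m. (x i)\<^sup>2)"
    by (simp add: sum_distrib_left flip: sum.distrib)
  finally show ?thesis .
qed

text \<open>Coercivity tested on finitely supported vectors: all sums are finite, so the property
  passes to the transpose by swapping sums.\<close>

definition finitely_elliptic :: "real \<Rightarrow> (nat \<Rightarrow> nat \<Rightarrow> real) \<Rightarrow> bool" where
  "finitely_elliptic c A \<longleftrightarrow>
     (\<forall>m x. c * (\<Sum>i<m. (x i)\<^sup>2) \<le> (\<Sum>i<m. \<Sum>j<m. x i * A i j * x j))"

lemma elliptic_imp_finitely_elliptic:
  assumes "elliptic c A"
  shows "finitely_elliptic c A"
  unfolding finitely_elliptic_def
proof (intro allI)
  fix m and x :: "nat \<Rightarrow> real"
  define y where "y = (\<lambda>i. if i < m then x i else 0)"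
  have fin: "(\<Sum>i. f i) = (\<Sum>i<m. f i)" if "\<And>i. i \<ge> m \<Longrightarrow> f i = 0" for f :: "nat \<Rightarrow> real"
    using that by (intro suminf_finite) auto
  have "l2 y"
    unfolding l2_def by (rule summable_finite[of "{..<m}"]) (auto simp: y_def)
  then have "c * (\<Sum>i. (y i)\<^sup>2) \<le> (\<Sum>i. mat_apply A y i * y i)"
    using assms by (auto simp: elliptic_def)
  also have "(\<Sum>i. (y i)\<^sup>2) = (\<Sum>i<m. (x i)\<^sup>2)"
    by (subst fin) (auto simp: y_def)
  also have "(\<Sum>i. mat_apply A y i * y i) = (\<Sum>i<m. mat_apply A y i * x i)"
    by (subst fin) (auto simp: y_def)
  also have "\<dots> = (\<Sum>i<m. \<Sum>j<m. x i * A i j * x j)"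
  proof (rule sum.cong[OF refl])
    fix i
    have "mat_apply A y i = (\<Sum>j<m. A i j * x j)"
      unfolding mat_apply_def by (subst fin) (auto simp: y_def)
    then show "mat_apply A y i * x i = (\<Sum>j<m. x i * A i j * x j)"
      by (simp add: sum_distrib_left mult_ac)
  qed
  finally show "c * (\<Sum>i<m. (x i)\<^sup>2) \<le> (\<Sum>i<m. \<Sum>j<m. x i * A i j * x j)" .
qed

lemma finitely_elliptic_transpose:
  assumes "finitely_elliptic c A"
  shows "finitely_elliptic c (\<lambda>i j. A j i)"
proof -
  have "(\<Sum>i<m. \<Sum>j<m. x i * A j i * x j) = (\<Sum>i<m. \<Sum>j<m. x i * A i j * x j)"
    for m and x :: "nat \<Rightarrow> real"
    by (subst sum.swap) (simp add: mult_ac)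
  then show ?thesis
    using assms by (simp add: finitely_elliptic_def)
qed

text \<open>Induction by bordering: a solution for the smaller section is corrected by a multiple of
  a vector that the first \<open>m\<close> rows annihilate, which is possible because the Schur
  complement is nonzero.\<close>

lemma finitely_elliptic_solve:
  assumes ell: "finitely_elliptic c A" and c: "c > 0"
  shows "\<exists>x. \<forall>i<m. (\<Sum>j<m. A i j * x j) = b i"
proof (induction m arbitrary: b)
  case 0
  then show ?case by simp
next
  case (Suc m)
  obtain x where x: "\<And>i. i < m \<Longrightarrow> (\<Sum>j<m. A i j * x j) = b i"
    using Suc.IH by blast
  obtain p where p: "\<And>i. i < m \<Longrightarrow> (\<Sum>j<m. A i j * p j) = - A i m"
    using Suc.IH[of "\<lambda>i. - A i m"] by blast
  define q where "q = p(m := 1)"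
  define s where "s = (\<Sum>j<Suc m. A m j * q j)"
  have q: "(\<Sum>j<Suc m. A i j * q j) = 0" if "i < m" for i
    using p[OF that] by (simp add: q_def)
  \<comment> \<open>Testing ellipticity with \<open>q\<close> leaves only the last row, whose value
    is the Schur complement \<open>s\<close>; hence \<open>s\<close> is at least
    \<open>c\<close>.\<close>
  have "c * 1 \<le> c * (\<Sum>i<Suc m. (q i)\<^sup>2)"
    using c by (intro mult_left_mono) (auto simp: q_def sum_nonneg)
  also have "\<dots> \<le> (\<Sum>i<Suc m. \<Sum>j<Suc m. q i * A i j * q j)"
    using ell unfolding finitely_elliptic_def by blast
  also have "\<dots> = (\<Sum>i<Suc m. q i * (\<Sum>j<Suc m. A i j * q j))"
    by (simp only: sum_distrib_left mult.assoc)
  also have "\<dots> = s"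
    unfolding sum.lessThan_Suc[of _ m]
    using q by (simp add: s_def q_def)
  finally have s: "s \<noteq> 0" using c by auto
  define t where "t = (b m - (\<Sum>j<m. A m j * x j)) / s"
  define X where "X = (\<lambda>j. (if j < m then x j else 0) + t * q j)"
  have X: "(\<Sum>j<Suc m. A i j * X j) = (\<Sum>j<m. A i j * x j) + t * (\<Sum>j<Suc m. A i j * q j)" for i
    by (simp add: X_def algebra_simps sum.distrib sum_distrib_left)
  have "(\<Sum>j<Suc m. A i j * X j) = b i" if "i < Suc m" for i
  proof (cases "i = m")
    case True
    then show ?thesis
      unfolding X using s by (simp only: t_def s_def[symmetric]) simp
  next
    case False
    then show ?thesis
      unfolding X using that x q by simp
  qed
  then show ?case by blast
qed

subsection \<open>Exponential decay of inverses of sections\<close>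

text \<open>
  Conjugating \<^term>\<open>A\<close> with the weights \<^term>\<open>exp (\<delta> * d i k)\<close> perturbs it, by the Schur
  test, by at most half of the ellipticity constant. The conjugated section is therefore still
  elliptic, and the bound on its inverse is the exponential decay of the column \<^term>\<open>k\<close> of the
  inverse of the section.
\<close>

lemma combes_thomas:
  fixes A d :: "nat \<Rightarrow> nat \<Rightarrow> real"
  assumes ell: "finitely_elliptic c A" and c: "c > 0" and \<delta>: "\<delta> \<ge> 0"
    and d0: "d k k = 0" and dsym: "\<And>i j. d i j = d j i"
    and dtri: "\<And>i j k. d i k \<le> d i j + d j k"
    and row: "\<And>i. i < m \<Longrightarrow> (\<Sum>j<m. \<bar>A i j\<bar> * (exp (\<delta> * d i j) - 1)) \<le> c / 2"
    and col: "\<And>j. j < m \<Longrightarrow> (\<Sum>i<m. \<bar>A i j\<bar> * (exp (\<delta> * d i j) - 1)) \<le> c / 2"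
    and k: "k < m"
    and y: "\<And>i. i < m \<Longrightarrow> (\<Sum>j<m. A i j * y j) = (if i = k then 1 else 0)"
    and j: "j < m"
  shows "\<bar>y j\<bar> \<le> 2 / c * exp (- \<delta> * d j k)"
proof -
  define \<eta> where "\<eta> i = exp (\<delta> * d i k) * y i" for i
  \<comment> \<open>\<open>K\<close> is the matrix \<open>A\<close> conjugated by the weights, with
    entries \<open>exp (\<delta> * d i k) * A i j * exp (- \<delta> * d j k)\<close>, minus
    \<open>A\<close> itself.\<close>
  define K where "K i j = A i j * (exp (\<delta> * (d i k - d j k)) - 1)" for i j
  have K: "\<bar>K i j\<bar> \<le> \<bar>A i j\<bar> * (exp (\<delta> * d i j) - 1)" for i j
  proof -
    define t where "t = d i k - d j k"
    have "\<bar>t\<bar> \<le> d i j"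
      using dtri[of i k j] dtri[of j k i] dsym[of i j] by (simp add: t_def)
    then have t: "\<bar>\<delta> * t\<bar> \<le> \<delta> * d i j"
      using \<delta> by (simp add: abs_mult mult_left_mono)
    have "\<bar>exp (\<delta> * t) - 1\<bar> \<le> exp \<bar>\<delta> * t\<bar> - 1"
    proof (cases "\<delta> * t \<ge> 0")
      case False
      define s where "s = exp (\<delta> * t)"
      have "s > 0" by (simp add: s_def)
      then have "2 \<le> s + 1 / s"
        using sum_squares_bound[of s 1] by (simp add: field_simps power2_eq_square)
      moreover have "exp \<bar>\<delta> * t\<bar> = 1 / s"
        using False by (simp add: s_def exp_minus field_simps)
      moreover have "s \<le> 1"
        using False by (simp add: s_def)
      ultimately show ?thesis by (simp flip: s_def)
    qed simp
    also have "\<dots> \<le> exp (\<delta> * d i j) - 1"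
      using t by simp
    finally show ?thesis
      unfolding K_def t_def[symmetric] abs_mult by (rule mult_left_mono) simp
  qed
  have rowK: "(\<Sum>j<m. \<bar>K i j\<bar>) \<le> c / 2" if "i < m" for i
    using sum_mono[of "{..<m}" "\<lambda>j. \<bar>K i j\<bar>", OF K] row[OF that] by (rule order_trans)
  have colK: "(\<Sum>i<m. \<bar>K i j\<bar>) \<le> c / 2" if "j < m" for j
    using sum_mono[of "{..<m}" "\<lambda>i. \<bar>K i j\<bar>", OF K] col[OF that] by (rule order_trans)
  have "c * (\<Sum>i<m. (\<eta> i)\<^sup>2) \<le> (\<Sum>i<m. \<Sum>j<m. \<eta> i * A i j * \<eta> j)"
    using ell by (simp add: finitely_elliptic_def)
  also have "\<dots> = (\<Sum>i<m. \<Sum>j<m. \<eta> i * exp (\<delta> * d i k) * (A i j * y j) - \<eta> i * K i j * \<eta> j)"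
  proof (intro sum.cong refl)
    fix i j
    have e: "exp (\<delta> * (d i k - d j k)) * exp (\<delta> * d j k) = exp (\<delta> * d i k)"
      by (simp add: algebra_simps flip: exp_add)
    have "\<eta> i * K i j * \<eta> j + \<eta> i * A i j * \<eta> j
        = \<eta> i * A i j * (exp (\<delta> * (d i k - d j k)) * exp (\<delta> * d j k)) * y j"
      by (simp add: K_def \<eta>_def algebra_simps)
    then show "\<eta> i * A i j * \<eta> j = \<eta> i * exp (\<delta> * d i k) * (A i j * y j) - \<eta> i * K i j * \<eta> j"
      unfolding e by (simp add: algebra_simps)
  qed
  also have "\<dots> = (\<Sum>i<m. \<eta> i * exp (\<delta> * d i k) * (\<Sum>j<m. A i j * y j))
      - (\<Sum>i<m. \<Sum>j<m. \<eta> i * K i j * \<eta> j)"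
    by (simp add: sum_subtractf sum_distrib_left)
  also have "(\<Sum>i<m. \<eta> i * exp (\<delta> * d i k) * (\<Sum>j<m. A i j * y j))
      = (\<Sum>i<m. if i = k then \<eta> k else 0)"
    using y by (intro sum.cong) (auto simp: d0)
  also have "\<dots> = \<eta> k"
    using k by simp
  \<comment> \<open>The section maps \<open>y\<close> to the unit vector at \<open>k\<close>, where
    the weight is 1, so only \<open>\<eta> k\<close> survives on the right; the Schur test for
    \<open>K\<close> consumes half of the ellipticity constant.\<close>
  finally have main: "c / 2 * (\<Sum>i<m. (\<eta> i)\<^sup>2) \<le> \<eta> k"
    using schur_test_quadratic_form[of m K "c / 2" \<eta>, OF rowK colK] by linarith
  have le: "c / 2 * (\<eta> i)\<^sup>2 \<le> \<eta> k" if "i < m" for i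
  proof -
    have "(\<eta> i)\<^sup>2 \<le> (\<Sum>i<m. (\<eta> i)\<^sup>2)"
      using that by (intro member_le_sum) auto
    then have "c / 2 * (\<eta> i)\<^sup>2 \<le> c / 2 * (\<Sum>i<m. (\<eta> i)\<^sup>2)"
      using c by (intro mult_left_mono) auto
    then show ?thesis using main by linarith
  qed
  \<comment> \<open>Taking the index \<open>k\<close> itself bounds \<open>\<eta> k\<close> by
    \<open>2 / c\<close>; this bound then controls all other entries through
    \<open>le\<close>.\<close>
  have "c / 2 * (\<eta> k * \<eta> k) \<le> \<eta> k"
    using le[OF k] by (simp add: power2_eq_square)
  moreover have "\<eta> k \<ge> 0"
    by (rule order_trans[OF _ le[OF k]]) (use c in simp)
  ultimately have \<eta>k: "\<eta> k \<le> 2 / c"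
    using c by (cases "\<eta> k = 0") (auto simp: field_simps)
  have "(\<eta> j)\<^sup>2 \<le> (2 / c)\<^sup>2"
  proof -
    have "(\<eta> j)\<^sup>2 \<le> 2 / c * \<eta> k"
      using le[OF j] c by (simp add: field_simps)
    also have "\<dots> \<le> 2 / c * (2 / c)"
      using \<eta>k c by (intro mult_left_mono) auto
    finally show ?thesis by (simp add: power2_eq_square)
  qed
  then have "\<bar>\<eta> j\<bar> \<le> 2 / c"
    using c by (metis abs_le_square_iff abs_of_pos divide_pos_pos zero_less_numeral)
  then have "exp (\<delta> * d j k) * \<bar>y j\<bar> \<le> 2 / c"
    by (simp add: \<eta>_def abs_mult)
  then show ?thesis
    using c by (simp add: exp_minus field_simps)
qed

lemma jaffard_metric_finite_sums:
  assumes "jaffard_metric d" "\<delta> > 0"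
  obtains B where "B > 0" "\<And>i m. (\<Sum>j<m. exp (- \<delta> * d i j)) \<le> B"
    "\<And>j m. (\<Sum>i<m. exp (- \<delta> * d i j)) \<le> B"
proof -
  obtain B where B: "\<And>i. summable (\<lambda>j. exp (- \<delta> * d i j))" "\<And>i. (\<Sum>j. exp (- \<delta> * d i j)) \<le> B"
    using assms unfolding jaffard_metric_def by meson
  have row: "(\<Sum>j<m. exp (- \<delta> * d i j)) \<le> B" for i m
    using sum_le_suminf[OF B(1), of "{..<m}" i] B(2)[of i] by simp
  have sym: "d i j = d j i" for i j
    using assms by (simp add: jaffard_metric_def)
  have "B > 0"
    by (rule less_le_trans[OF exp_gt_zero]) (use row[where i = 0 and m = 1] in simp)
  then show ?thesis
    using that[of B] row sym by simp
qed

text \<open>The perturbation is of order \<delta> uniformly in \<open>s\<close>: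
  \<open>exp (\<delta> * s) - 1\<close> is at most \<open>\<delta> * s * exp (\<delta> * s)\<close>.
  Absorbing \<open>s\<close> and the last exponential each costs a quarter of the rate \<gamma>, so
  half of it remains.\<close>

lemma exp_weight_bound:
  fixes \<delta> \<gamma> s :: real
  assumes "0 \<le> \<delta>" "\<delta> \<le> \<gamma> / 4" "\<gamma> > 0" "s \<ge> 0"
  shows "exp (- \<gamma> * s) * (exp (\<delta> * s) - 1) \<le> \<delta> * (4 / \<gamma>) * exp (- (\<gamma> / 2) * s)"
proof -
  have "1 - exp (- (\<delta> * s)) \<le> \<delta> * s"
    using exp_ge_add_one_self[of "- (\<delta> * s)"] by linarith
  then have "exp (\<delta> * s) * (1 - exp (- (\<delta> * s))) \<le> exp (\<delta> * s) * (\<delta> * s)"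
    by (intro mult_left_mono) auto
  then have "exp (\<delta> * s) - 1 \<le> \<delta> * s * exp (\<delta> * s)"
    by (simp add: algebra_simps flip: exp_add)
  also have "\<dots> \<le> \<delta> * (4 / \<gamma> * exp (\<gamma> / 4 * s)) * exp (\<gamma> / 4 * s)"
  proof (intro mult_mono)
    have "\<gamma> / 4 * s \<le> exp (\<gamma> / 4 * s)"
      using exp_ge_add_one_self[of "\<gamma> / 4 * s"] by linarith
    then show "s \<le> 4 / \<gamma> * exp (\<gamma> / 4 * s)"
      using assms by (simp add: field_simps)
    show "exp (\<delta> * s) \<le> exp (\<gamma> / 4 * s)"
      using mult_right_mono[OF assms(2,4)] by simp
  qed (use assms in auto)
  also have "\<dots> = \<delta> * (4 / \<gamma>) * exp (\<gamma> / 2 * s)"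
    by (simp flip: exp_add)
  finally have "exp (- \<gamma> * s) * (exp (\<delta> * s) - 1) \<le> exp (- \<gamma> * s) * (\<delta> * (4 / \<gamma>) * exp (\<gamma> / 2 * s))"
    by (rule mult_left_mono) simp
  also have "\<dots> = \<delta> * (4 / \<gamma>) * (exp (- \<gamma> * s) * exp (\<gamma> / 2 * s))"
    by simp
  also have "exp (- \<gamma> * s) * exp (\<gamma> / 2 * s) = exp (- (\<gamma> / 2) * s)"
    by (simp flip: exp_add)
  finally show ?thesis .
qed

text \<open>The rate \<delta> is fixed before \<open>A\<close>, from the metric, \<gamma>,
  \<open>c\<close> and \<open>K\<close> alone. This uniformity keeps the final constant independent
  of the individual matrix.\<close>

lemma section_inverse_decay:
  assumes d: "jaffard_metric d" and \<gamma>: "\<gamma> > 0" and c: "c > 0" and K: "K > 0"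
  shows "\<exists>\<delta>>0. \<forall>A. finitely_elliptic c A \<longrightarrow> (\<forall>i j. \<bar>A i j\<bar> \<le> K * exp (- \<gamma> * d i j)) \<longrightarrow>
    (\<forall>m. \<forall>k<m. \<forall>y. (\<forall>i<m. (\<Sum>j<m. A i j * y j) = (if i = k then 1 else 0)) \<longrightarrow>
      (\<forall>j<m. \<bar>y j\<bar> \<le> 2 / c * exp (- \<delta> * d j k)))"
proof -
  obtain B where B: "B > 0" "\<And>i m. (\<Sum>j<m. exp (- (\<gamma> / 2) * d i j)) \<le> B"
    "\<And>j m. (\<Sum>i<m. exp (- (\<gamma> / 2) * d i j)) \<le> B"
    using jaffard_metric_finite_sums[OF d half_gt_zero[OF \<gamma>]] by blast
  have d': "0 \<le> d i j" "d i i = 0" "d i j = d j i" "d i k \<le> d i j + d j k" for i j k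
    using d by (auto simp: jaffard_metric_def)
  \<comment> \<open>The first bound is the one required by \<open>exp_weight_bound\<close>; the
    second makes the weighted row and column sums at most \<open>c / 2\<close>.\<close>
  define \<delta> where "\<delta> = min (\<gamma> / 4) (c * \<gamma> / (8 * K * B))"
  have \<delta>: "\<delta> > 0" "\<delta> \<le> \<gamma> / 4" "K * \<delta> * (4 / \<gamma>) * B \<le> c / 2"
  proof -
    have "\<delta> \<le> c * \<gamma> / (8 * K * B)" by (simp add: \<delta>_def)
    then show "K * \<delta> * (4 / \<gamma>) * B \<le> c / 2"
      using \<gamma> K B(1) by (simp add: field_simps)
  qed (use \<gamma> c K B(1) in \<open>auto simp: \<delta>_def\<close>)
  show ?thesis
  proof (rule exI[of _ \<delta>], intro conjI allI impI)
    fix A :: "nat \<Rightarrow> nat \<Rightarrow> real" and m k j :: nat and y :: "nat \<Rightarrow> real"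
    assume ell: "finitely_elliptic c A" and "\<forall>i j. \<bar>A i j\<bar> \<le> K * exp (- \<gamma> * d i j)"
      and k: "k < m" and j: "j < m"
      and "\<forall>i<m. (\<Sum>j<m. A i j * y j) = (if i = k then 1 else 0)"
    then have A: "\<And>i j. \<bar>A i j\<bar> \<le> K * exp (- \<gamma> * d i j)"
      and y: "\<And>i. i < m \<Longrightarrow> (\<Sum>j<m. A i j * y j) = (if i = k then 1 else 0)" by auto
    have AK: "\<bar>A i j\<bar> * (exp (\<delta> * d i j) - 1) \<le> K * \<delta> * (4 / \<gamma>) * exp (- (\<gamma> / 2) * d i j)" for i j
    proof -
      have "\<bar>A i j\<bar> * (exp (\<delta> * d i j) - 1) \<le> K * exp (- \<gamma> * d i j) * (exp (\<delta> * d i j) - 1)"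
        using \<delta> d' by (intro mult_right_mono A) simp
      also have "\<dots> \<le> K * (\<delta> * (4 / \<gamma>) * exp (- (\<gamma> / 2) * d i j))"
        unfolding mult.assoc[of K]
        by (intro mult_left_mono exp_weight_bound) (use \<delta> \<gamma> K d' in auto)
      finally show ?thesis by (simp add: mult_ac)
    qed
    have KB: "K * \<delta> * (4 / \<gamma>) * s \<le> c / 2" if "s \<le> B" for s
      by (rule order_trans[OF mult_left_mono[OF that] \<delta>(3)]) (use K \<delta> \<gamma> in auto)
    show "\<bar>y j\<bar> \<le> 2 / c * exp (- \<delta> * d j k)"
    proof (rule combes_thomas[where d = d and m = m and A = A, OF ell c _ d'(2) d'(3) d'(4) _ _ k y j])
      show "(\<Sum>j<m. \<bar>A i j\<bar> * (exp (\<delta> * d i j) - 1)) \<le> c / 2" for i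
        by (rule order_trans[OF sum_mono[OF AK]]) (simp only: KB[OF B(2)] flip: sum_distrib_left)
      show "(\<Sum>i<m. \<bar>A i j\<bar> * (exp (\<delta> * d i j) - 1)) \<le> c / 2" for j
        by (rule order_trans[OF sum_mono[OF AK]]) (simp only: KB[OF B(3)] flip: sum_distrib_left)
    qed (use \<delta> in auto)
  qed (rule \<delta>(1))
qed

subsection \<open>Bounded triangular factorizations\<close>

text \<open>Bounding all partial sums of nonnegative terms encodes absolutely convergent rows and
  columns together with a bound on their sums.\<close>

definition schur_bounded :: "real \<Rightarrow> (nat \<Rightarrow> nat \<Rightarrow> real) \<Rightarrow> bool" where
  "schur_bounded S T \<longleftrightarrow>
     (\<forall>i m. (\<Sum>j<m. \<bar>T i j\<bar>) \<le> S) \<and> (\<forall>j m. (\<Sum>i<m. \<bar>T i j\<bar>) \<le> S)"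

lemma schur_bounded_mono: "schur_bounded S T \<Longrightarrow> S \<le> S' \<Longrightarrow> schur_bounded S' T"
  unfolding schur_bounded_def by (meson order_trans)

lemma schur_bounded_sum_le:
  "schur_bounded S T \<Longrightarrow> (\<Sum>i<m. (\<Sum>j<p. T i j * x j)\<^sup>2) \<le> S\<^sup>2 * (\<Sum>j<p. (x j)\<^sup>2)"
  unfolding schur_bounded_def by (intro schur_test) auto

lemma schur_bounded_if_decay:
  assumes T: "\<And>i j. \<bar>T i j\<bar> \<le> K * exp (- \<delta> * d i j)" and K: "K \<ge> 0"
    and row: "\<And>i m. (\<Sum>j<m. exp (- \<delta> * d i j)) \<le> B"
    and col: "\<And>j m. (\<Sum>i<m. exp (- \<delta> * d i j)) \<le> B"
  shows "schur_bounded (K * B) T"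
  unfolding schur_bounded_def
proof (intro conjI allI)
  show "(\<Sum>j<m. \<bar>T i j\<bar>) \<le> K * B" for i m
    by (rule order_trans[OF sum_mono[OF T]])
      (use mult_left_mono[OF row K] in \<open>simp flip: sum_distrib_left\<close>)
  show "(\<Sum>i<m. \<bar>T i j\<bar>) \<le> K * B" for j m
    by (rule order_trans[OF sum_mono[OF T]])
      (use mult_left_mono[OF col K] in \<open>simp flip: sum_distrib_left\<close>)
qed

text \<open>
  Up to a diagonal scaling, \<^term>\<open>Z\<close> and \<^term>\<open>Q\<close> are the inverses of the factors of an LU
  decomposition of \<^term>\<open>A\<close>: row \<^term>\<open>n\<close> of \<^term>\<open>Z\<close> and column \<^term>\<open>n\<close> of \<^term>\<open>Q\<close> are
  multiples of the last row and the last column of the inverse of the section of \<^term>\<open>A\<close> with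
  indices up to \<^term>\<open>n\<close>.
\<close>

locale triangular_factorization =
  fixes S :: real and A Z Q :: "nat \<Rightarrow> nat \<Rightarrow> real"
  assumes A_bounded: "schur_bounded S A"
    and Z_bounded: "schur_bounded S Z"
    and Q_bounded: "schur_bounded S Q"
    and Z_lower: "n < i \<Longrightarrow> Z n i = 0"
    and ZA_upper: "j \<le> n \<Longrightarrow> (\<Sum>i\<le>n. Z n i * A i j) = (if j = n then 1 else 0)"
    and Q_upper: "k < j \<Longrightarrow> Q j k = 0"
    and Q_diag: "Q k k = 1"
    and AQ_lower: "i < k \<Longrightarrow> (\<Sum>j\<le>k. A i j * Q j k) = 0"

text \<open>Rows of \<open>Z\<close> and columns of \<open>Q\<close> solve section systems, so they
  inherit exponential decay and the Schur bounds follow. Normalizing \<open>Q\<close> to unit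
  diagonal also requires the pivots \<open>y n n\<close> to stay away from zero.\<close>

lemma triangular_factorization_exists:
  assumes d: "jaffard_metric d" and \<gamma>: "\<gamma> > 0" and c: "c > 0" and K: "K > 0"
  shows "\<exists>S>0. \<forall>A. finitely_elliptic c A \<longrightarrow> (\<forall>i j. \<bar>A i j\<bar> \<le> K * exp (- \<gamma> * d i j))
    \<longrightarrow> (\<exists>Z Q. triangular_factorization S A Z Q)"
proof -
  obtain \<delta> where \<delta>: "\<delta> > 0" and decay:
    "\<forall>A. finitely_elliptic c A \<longrightarrow> (\<forall>i j. \<bar>A i j\<bar> \<le> K * exp (- \<gamma> * d i j)) \<longrightarrow>
      (\<forall>m. \<forall>k<m. \<forall>y. (\<forall>i<m. (\<Sum>j<m. A i j * y j) = (if i = k then 1 else 0)) \<longrightarrow>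
        (\<forall>j<m. \<bar>y j\<bar> \<le> 2 / c * exp (- \<delta> * d j k)))"
    using section_inverse_decay[OF d \<gamma> c K] by (elim exE conjE)
  obtain B1 where B1: "B1 > 0" "\<And>i m. (\<Sum>j<m. exp (- \<gamma> * d i j)) \<le> B1"
    "\<And>j m. (\<Sum>i<m. exp (- \<gamma> * d i j)) \<le> B1"
    using jaffard_metric_finite_sums[OF d \<gamma>] by blast
  obtain B2 where B2: "B2 > 0" "\<And>i m. (\<Sum>j<m. exp (- \<delta> * d i j)) \<le> B2"
    "\<And>j m. (\<Sum>i<m. exp (- \<delta> * d i j)) \<le> B2"
    using jaffard_metric_finite_sums[OF d \<delta>] by blast
  have sym: "d i j = d j i" for i j
    using d by (simp add: jaffard_metric_def)
  define SA where "SA = K * B1"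
  \<comment> \<open>The factor \<open>2 / c\<close> is the decay constant of section inverses, and
    \<open>SA\<^sup>2 / c\<close> bounds the reciprocal pivots.\<close>
  define KQ where "KQ = 2 / c * (SA\<^sup>2 / c)"
  define S where "S = SA + 2 / c * B2 + KQ * B2"
  have pos: "SA > 0" "2 / c > 0" "KQ > 0"
    using K B1(1) c by (auto simp: SA_def KQ_def)
  have S: "S > 0" "SA \<le> S" "2 / c * B2 \<le> S" "KQ * B2 \<le> S"
  proof -
    have "2 / c * B2 > 0" "KQ * B2 > 0"
      using pos B2(1) by (simp_all only: mult_pos_pos)
    then show "S > 0" "SA \<le> S" "2 / c * B2 \<le> S" "KQ * B2 \<le> S"
      using pos(1) by (simp_all only: S_def)
  qed
  show ?thesis
  proof (rule exI[of _ S], intro conjI allI impI)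
    fix A assume ell: "finitely_elliptic c A" and "\<forall>i j. \<bar>A i j\<bar> \<le> K * exp (- \<gamma> * d i j)"
    then have A: "\<And>i j. \<bar>A i j\<bar> \<le> K * exp (- \<gamma> * d i j)" by blast
    have A_schur: "schur_bounded SA A"
      unfolding SA_def by (rule schur_bounded_if_decay[OF A]) (use K B1 in auto)
    have "\<forall>n. \<exists>y. \<forall>i<Suc n. (\<Sum>j<Suc n. A j i * y j) = (if i = n then 1 else 0)"
      by (intro allI finitely_elliptic_solve[OF finitely_elliptic_transpose[OF ell] c])
    from choice[OF this] obtain z where
      z: "\<And>n i. i < Suc n \<Longrightarrow> (\<Sum>j<Suc n. A j i * z n j) = (if i = n then 1 else 0)"
      by (auto simp del: sum.lessThan_Suc)
    have "\<forall>n. \<exists>y. \<forall>i<Suc n. (\<Sum>j<Suc n. A i j * y j) = (if i = n then 1 else 0)"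
      by (intro allI finitely_elliptic_solve[OF ell c])
    from choice[OF this] obtain y where
      y: "\<And>n i. i < Suc n \<Longrightarrow> (\<Sum>j<Suc n. A i j * y n j) = (if i = n then 1 else 0)"
      by (auto simp del: sum.lessThan_Suc)
    have A_t: "\<bar>A j i\<bar> \<le> K * exp (- \<gamma> * d i j)" for i j
      unfolding sym[of i j] by (rule A)
    have z_decay: "\<bar>z n j\<bar> \<le> 2 / c * exp (- \<delta> * d n j)" if "j < Suc n" for n j
      unfolding sym[of n j]
      by (rule decay[rule_format, OF finitely_elliptic_transpose[OF ell] A_t _ z that]) auto
    have y_decay: "\<bar>y n j\<bar> \<le> 2 / c * exp (- \<delta> * d j n)" if "j < Suc n" for n j
      by (rule decay[rule_format, OF ell A _ y that]) auto
    \<comment> \<open>The section has norm at most \<open>SA\<close> and maps \<open>y n\<close> to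
      a unit vector, so \<open>y n\<close> has norm at least \<open>1 / SA\<close>. Ellipticity
      tested with \<open>y n\<close> then yields the pivot bound.\<close>
    have y_diag: "c / SA\<^sup>2 \<le> y n n" for n
    proof -
      have "1 = (\<Sum>j<Suc n. A n j * y n j)\<^sup>2"
        using y[of n n] by simp
      also have "\<dots> \<le> (\<Sum>i<Suc n. (\<Sum>j<Suc n. A i j * y n j)\<^sup>2)"
        by (rule member_le_sum[of n "{..<Suc n}" "\<lambda>i. (\<Sum>j<Suc n. A i j * y n j)\<^sup>2"]) auto
      also have "\<dots> \<le> SA\<^sup>2 * (\<Sum>j<Suc n. (y n j)\<^sup>2)"
        by (rule schur_bounded_sum_le[OF A_schur])
      finally have "1 / SA\<^sup>2 \<le> (\<Sum>j<Suc n. (y n j)\<^sup>2)"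
        using pos(1) by (simp add: divide_le_eq mult.commute del: sum.lessThan_Suc)
      then have "c / SA\<^sup>2 \<le> c * (\<Sum>j<Suc n. (y n j)\<^sup>2)"
        using mult_left_mono[of "1 / SA\<^sup>2" _ c] c by (simp del: sum.lessThan_Suc)
      also have "\<dots> \<le> (\<Sum>i<Suc n. \<Sum>j<Suc n. y n i * A i j * y n j)"
        using ell unfolding finitely_elliptic_def by blast
      also have "\<dots> = (\<Sum>i<Suc n. y n i * (\<Sum>j<Suc n. A i j * y n j))"
        by (simp only: sum_distrib_left mult.assoc)
      also have "\<dots> = (\<Sum>i<Suc n. if i = n then y n n else 0)"
        by (intro sum.cong refl) (use y in \<open>auto simp del: sum.lessThan_Suc\<close>)
      also have "\<dots> = y n n" by simp
      finally show ?thesis .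
    qed
    have y_pos: "y n n > 0" for n
      by (rule less_le_trans[OF _ y_diag]) (use c pos(1) in simp)
    define Z where "Z n j = (if j \<le> n then z n j else 0)" for n j
    define Q where "Q j k = (if j \<le> k then y k j / y k k else 0)" for j k
    have "triangular_factorization S A Z Q"
    proof
      show "schur_bounded S A"
        using schur_bounded_mono[OF A_schur S(2)] .
      have Z_decay: "\<bar>Z n j\<bar> \<le> 2 / c * exp (- \<delta> * d n j)" for n j
        using z_decay[of j n] pos(2) by (simp add: Z_def less_Suc_eq_le)
      have "schur_bounded (2 / c * B2) Z"
        by (rule schur_bounded_if_decay[OF Z_decay]) (use pos(2) B2 in auto)
      then show "schur_bounded S Z"
        by (rule schur_bounded_mono[OF _ S(3)])
      have Q_decay: "\<bar>Q j k\<bar> \<le> KQ * exp (- \<delta> * d j k)" for j k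
      proof (cases "j \<le> k")
        case True
        have "\<bar>y k j / y k k\<bar> = \<bar>y k j\<bar> * (1 / y k k)"
          using y_pos[of k] by (simp add: abs_divide)
        also have "\<dots> \<le> (2 / c * exp (- \<delta> * d j k)) * (SA\<^sup>2 / c)"
        proof (rule mult_mono)
          show "1 / y k k \<le> SA\<^sup>2 / c"
            using y_diag[of k] y_pos[of k] pos(1) c by (simp add: field_simps)
        qed (use True y_decay[of j k] y_pos[of k] c in auto)
        finally show ?thesis
          using True by (simp add: Q_def KQ_def mult_ac)
      next
        case False
        then show ?thesis using pos(3) by (simp add: Q_def)
      qed
      have "schur_bounded (KQ * B2) Q"
        by (rule schur_bounded_if_decay[OF Q_decay]) (use pos(3) B2 in auto)
      then show "schur_bounded S Q"
        by (rule schur_bounded_mono[OF _ S(4)])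
      show "(\<Sum>i\<le>n. Z n i * A i j) = (if j = n then 1 else 0)" if "j \<le> n" for j n
        using z[of j n] that
        by (simp add: Z_def mult.commute flip: lessThan_Suc_atMost del: sum.lessThan_Suc)
      show "(\<Sum>j\<le>k. A i j * Q j k) = 0" if "i < k" for i k
      proof -
        have "(\<Sum>j\<le>k. A i j * Q j k) = (\<Sum>j<Suc k. A i j * y k j) / y k k"
          unfolding sum_divide_distrib lessThan_Suc_atMost by (intro sum.cong) (auto simp: Q_def)
        then show ?thesis
          using y[of i k] that by simp
      qed
    qed (use y_pos in \<open>auto simp: Z_def Q_def less_imp_neq[THEN not_sym]\<close>)
    then show "\<exists>Z Q. triangular_factorization S A Z Q" by blast
  qed (rule S(1))
qed

section \<open>Action of the factors on square-summable sequences\<close>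

text \<open>Entries of an l2 sequence are bounded, so absolute summability of the rows gives
  convergence. The estimate is the finite Schur test in the limit of many columns, with the number
  of rows kept fixed.\<close>

lemma schur_bounded_mat_apply:
  assumes T: "schur_bounded S T" and x: "l2 x"
  shows "summable (\<lambda>j. T i j * x j)"
    and "(\<Sum>i<m. (mat_apply T x i)\<^sup>2) \<le> S\<^sup>2 * (\<Sum>j. (x j)\<^sup>2)"
proof -
  have sx: "summable (\<lambda>j. (x j)\<^sup>2)"
    using x by (simp add: l2_def)
  have le: "(\<Sum>j<p. (x j)\<^sup>2) \<le> (\<Sum>j. (x j)\<^sup>2)" for p
    by (rule sum_le_suminf[OF sx]) auto
  show sum: "summable (\<lambda>j. T i j * x j)" for i
  proof (rule summable_comparison_test)
    have "summable (\<lambda>j. \<bar>T i j\<bar>)"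
      using T by (intro summableI_nonneg_bounded[of _ S]) (auto simp: schur_bounded_def)
    then show "summable (\<lambda>j. \<bar>T i j\<bar> * (1 + (\<Sum>j. (x j)\<^sup>2)))"
      by (rule summable_mult2)
    have "\<bar>x j\<bar> \<le> 1 + (\<Sum>j. (x j)\<^sup>2)" for j
    proof -
      have "\<bar>x j\<bar> \<le> 1 + (x j)\<^sup>2"
        using sum_squares_bound[of "\<bar>x j\<bar>" 1] abs_ge_zero[of "x j"] by simp
      moreover have "(x j)\<^sup>2 \<le> (\<Sum>j<Suc j. (x j)\<^sup>2)"
        by (simp add: sum_nonneg)
      ultimately show ?thesis
        using le[of "Suc j"] by linarith
    qed
    then show "\<exists>N. \<forall>n\<ge>N. norm (T i n * x n) \<le> \<bar>T i n\<bar> * (1 + (\<Sum>j. (x j)\<^sup>2))"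
      by (simp add: abs_mult mult_left_mono)
  qed
  have "(\<lambda>p. \<Sum>i<m. (\<Sum>j<p. T i j * x j)\<^sup>2) \<longlonglongrightarrow> (\<Sum>i<m. (mat_apply T x i)\<^sup>2)"
    unfolding mat_apply_def by (intro tendsto_intros summable_LIMSEQ sum)
  then show "(\<Sum>i<m. (mat_apply T x i)\<^sup>2) \<le> S\<^sup>2 * (\<Sum>j. (x j)\<^sup>2)"
  proof (rule LIMSEQ_le_const2, intro exI allI impI)
    fix p
    show "(\<Sum>i<m. (\<Sum>j<p. T i j * x j)\<^sup>2) \<le> S\<^sup>2 * (\<Sum>j. (x j)\<^sup>2)"
      using schur_bounded_sum_le[OF T, where m = m and p = p and x = x]
        mult_left_mono[OF le[of p], of "S\<^sup>2"] by simp
  qed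
qed

context triangular_factorization
begin

text \<open>This is \<open>Z\<close> applied to \<open>A x\<close>. The infinite series is evaluated
  first, so the sum against the lower triangular \<open>Z\<close> stays finite; the product matrix
  appears separately as \<open>T\<close>.\<close>

definition U :: "(nat \<Rightarrow> real) \<Rightarrow> nat \<Rightarrow> real" where
  "U x n = (\<Sum>i\<le>n. Z n i * mat_apply A x i)"

lemma U_diff:
  assumes "l2 x" "l2 y"
  shows "U (\<lambda>j. x j - y j) n = U x n - U y n"
proof -
  have "mat_apply A (\<lambda>j. x j - y j) i = mat_apply A x i - mat_apply A y i" for i
    unfolding mat_apply_def right_diff_distrib
    by (rule suminf_diff[symmetric]; rule schur_bounded_mat_apply(1)[OF A_bounded]; fact)
  then show ?thesis
    by (simp add: U_def right_diff_distrib sum_subtractf)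
qed

text \<open>Since \<open>Z\<close> is lower triangular, the first \<open>m\<close> entries of
  \<open>U x\<close> see only the first \<open>m\<close> entries of \<open>A x\<close>. Small
  residuals on a section therefore stay small under \<open>U\<close>.\<close>

lemma U_le_section: "(\<Sum>n<m. (U x n)\<^sup>2) \<le> S\<^sup>2 * (\<Sum>i<m. (mat_apply A x i)\<^sup>2)"
proof -
  have "U x n = (\<Sum>i<m. Z n i * mat_apply A x i)" if "n < m" for n
    unfolding U_def by (rule sum.mono_neutral_left) (use that Z_lower in auto)
  then have "(\<Sum>n<m. (U x n)\<^sup>2) = (\<Sum>n<m. (\<Sum>i<m. Z n i * mat_apply A x i)\<^sup>2)"
    by simp
  then show ?thesis
    using schur_bounded_sum_le[OF Z_bounded] by simp
qed

lemma U_le: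
  assumes "l2 x"
  shows "(\<Sum>n<m. (U x n)\<^sup>2) \<le> S\<^sup>2 * S\<^sup>2 * (\<Sum>j. (x j)\<^sup>2)"
  using order_trans[OF U_le_section[of x m]
      mult_left_mono[OF schur_bounded_mat_apply(2)[OF A_bounded assms, of m], of "S\<^sup>2"]]
  by (simp add: mult.assoc)

definition T :: "nat \<Rightarrow> nat \<Rightarrow> real" where
  "T n j = (\<Sum>i\<le>n. Z n i * A i j)"

lemma U_finite:
  assumes "\<And>j. j \<ge> m \<Longrightarrow> x j = 0"
  shows "U x n = (\<Sum>j<m. T n j * x j)"
proof -
  have "mat_apply A x i = (\<Sum>j<m. A i j * x j)" for i
    unfolding mat_apply_def by (rule suminf_finite) (use assms in auto)
  then have "U x n = (\<Sum>i\<le>n. \<Sum>j<m. Z n i * A i j * x j)"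
    by (simp add: U_def sum_distrib_left mult.assoc)
  then show ?thesis
    by (subst (asm) sum.swap) (simp add: T_def sum_distrib_right)
qed

lemma T_upper: "j \<le> n \<Longrightarrow> T n j = (if j = n then 1 else 0)"
  unfolding T_def by (rule ZA_upper)

text \<open>Regrouped as \<open>Z\<close> times \<open>A Q\<close>, the sum involves only rows
  \<open>i\<close> of \<open>A Q\<close> with \<open>i\<close> at most \<open>n\<close>, and these
  vanish in column \<open>k\<close> by \<open>AQ_lower\<close>.\<close>

lemma TQ_upper_zero:
  assumes "n < k"
  shows "(\<Sum>j<Suc k. T n j * Q j k) = 0"
proof -
  have "(\<Sum>j\<le>k. T n j * Q j k) = (\<Sum>i\<le>n. Z n i * (\<Sum>j\<le>k. A i j * Q j k))"
    unfolding T_def sum_distrib_right sum_distrib_left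
    by (subst sum.swap) (simp add: mult.assoc)
  also have "\<dots> = 0"
    using AQ_lower assms by simp
  finally show ?thesis by (simp only: lessThan_Suc_atMost)
qed

lemma U_finite_zero:
  assumes "\<And>j. j \<ge> m \<Longrightarrow> x j = 0" "m \<le> n"
  shows "U x n = 0"
  using assms T_upper by (subst U_finite[of m]) (auto intro!: sum.neutral)

text \<open>\<open>Q\<close> inverts \<open>T\<close> on finitely supported vectors. Subtracting
  \<open>x m\<close> times column \<open>m\<close> of \<open>Q\<close> removes the last entry, as
  the diagonal is 1, and by \<open>TQ_upper_zero\<close> leaves the image in the earlier rows
  unchanged.\<close>

lemma reconstruct:
  assumes "\<And>j. j \<ge> m \<Longrightarrow> x j = 0"
  shows "x j = (\<Sum>k<m. Q j k * (\<Sum>l<m. T k l * x l))"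
  using assms
proof (induction m arbitrary: x j)
  case 0
  then show ?case by simp
next
  case (Suc m)
  define x' where "x' j = x j - x m * Q j m" for j
  have x': "x' j = 0" if "j \<ge> m" for j
    using that Suc.prems[of j] Q_upper[of m j] Q_diag[of m] by (cases "j = m") (auto simp: x'_def)
  have T': "(\<Sum>l<m. T k l * x' l) = (\<Sum>l<Suc m. T k l * x l)" if "k < m" for k
  proof -
    have "(\<Sum>l<m. T k l * x' l) = (\<Sum>l<Suc m. T k l * x' l)"
      using x'[of m] by simp
    also have "\<dots> = (\<Sum>l<Suc m. T k l * x l) - x m * (\<Sum>l<Suc m. T k l * Q l m)"
      unfolding sum_distrib_left sum_subtractf[symmetric]
      by (intro sum.cong) (auto simp: x'_def algebra_simps)
    finally show ?thesis
      unfolding TQ_upper_zero[OF that] by simp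
  qed
  have Tm: "(\<Sum>l<Suc m. T m l * x l) = x m"
    using T_upper[of _ m] by simp
  have "x j = x' j + Q j m * x m"
    by (simp add: x'_def)
  also have "x' j = (\<Sum>k<m. Q j k * (\<Sum>l<m. T k l * x' l))"
    by (rule Suc.IH[OF x'])
  also have "\<dots> = (\<Sum>k<m. Q j k * (\<Sum>l<Suc m. T k l * x l))"
    using T' by (intro sum.cong) (auto simp del: sum.lessThan_Suc)
  finally show ?case
    unfolding sum.lessThan_Suc[of "\<lambda>k. Q j k * _ k"] Tm .
qed

lemma U_ge_finite:
  assumes "\<And>j. j \<ge> m \<Longrightarrow> x j = 0"
  shows "(\<Sum>j<m. (x j)\<^sup>2) \<le> S\<^sup>2 * (\<Sum>n<m. (U x n)\<^sup>2)"
proof -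
  have "(\<Sum>j<m. (x j)\<^sup>2) = (\<Sum>j<m. (\<Sum>k<m. Q j k * U x k)\<^sup>2)"
  proof (rule sum.cong[OF refl])
    fix j
    have "U x k = (\<Sum>l<m. T k l * x l)" for k
      by (rule U_finite) (rule assms)
    moreover have "x j = (\<Sum>k<m. Q j k * (\<Sum>l<m. T k l * x l))"
      by (rule reconstruct) (rule assms)
    ultimately show "(x j)\<^sup>2 = (\<Sum>k<m. Q j k * U x k)\<^sup>2" by simp
  qed
  also have "\<dots> \<le> S\<^sup>2 * (\<Sum>n<m. (U x n)\<^sup>2)"
    by (rule schur_bounded_sum_le[OF Q_bounded])
  finally show ?thesis .
qed

end

subsection \<open>Quasi-orthogonality\<close>

lemma l2_diff:
  assumes "l2 x" "l2 y"
  shows "l2 (\<lambda>j. x j - y j)"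
proof -
  have s: "summable (\<lambda>j. 2 * (x j)\<^sup>2 + 2 * (y j)\<^sup>2)"
    using assms by (intro summable_add summable_mult) (auto simp: l2_def)
  have "(x j - y j)\<^sup>2 \<le> 2 * (x j)\<^sup>2 + 2 * (y j)\<^sup>2" for j
    using zero_le_power2[of "x j + y j"] by (simp add: power2_sum power2_diff)
  then show ?thesis
    unfolding l2_def by (intro summable_comparison_test'[OF s, of 0]) simp
qed

lemma l2_finite:
  assumes "\<And>j. m \<le> j \<Longrightarrow> x j = 0"
  shows "l2 x"
  unfolding l2_def by (rule summable_finite[of "{..<m}"]) (use assms in auto)

context triangular_factorization
begin

text \<open>The image of an increment under \<open>U\<close> is \<open>r k - r (Suc k)\<close>.
  Below \<open>N (Suc k)\<close> the second term is residual-sized, and so is the first below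
  \<open>N k\<close>; from \<open>N k\<close> on the first equals \<open>U x\<close>. These
  remaining blocks are disjoint for different \<open>k\<close>.\<close>

lemma quasi_orthogonality:
  fixes x :: "nat \<Rightarrow> real" and xs :: "nat \<Rightarrow> nat \<Rightarrow> real" and N :: "nat \<Rightarrow> nat"
  defines "err k \<equiv> (\<Sum>j. (x j - xs k j)\<^sup>2)"
  assumes x: "l2 x" and N: "mono N"
    and supp: "\<And>k j. N k \<le> j \<Longrightarrow> xs k j = 0"
    and res: "\<And>k. (\<Sum>i<N k. (mat_apply A (\<lambda>j. x j - xs k j) i)\<^sup>2) \<le> \<epsilon>\<^sup>2 * err k"
  shows "(\<Sum>k=l..l+n. \<Sum>j<N (Suc k). (xs (Suc k) j - xs k j)\<^sup>2)
    \<le> 2 * S ^ 6 * err l + 2 * S ^ 4 * \<epsilon>\<^sup>2 * (\<Sum>k=l..l+n. err k + err (Suc k))"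
proof -
  have l2_xs: "l2 (xs k)" for k
    by (rule l2_finite) (rule supp)
  have l2_diff: "l2 (\<lambda>j. x j - xs k j)" for k
    by (rule l2_diff[OF x l2_xs])
  have Ndiff: "N k \<le> N (Suc k)" for k
    using N by (simp add: monoD)
  define r where "r k n = U x n - U (xs k) n" for k n
  have r: "U (\<lambda>j. x j - xs k j) n = r k n" for k n
    unfolding r_def by (rule U_diff[OF x l2_xs])
  have r_small: "(\<Sum>n<N k. (r k n)\<^sup>2) \<le> S\<^sup>2 * (\<epsilon>\<^sup>2 * err k)" for k
    using order_trans[OF U_le_section mult_left_mono[OF res]] unfolding r by simp
  have r_tail: "r k n = U x n" if "N k \<le> n" for k n
    unfolding r_def using U_finite_zero[of "N k" "xs k" n] supp that by simp
  have step: "(\<Sum>j<N (Suc k). (xs (Suc k) j - xs k j)\<^sup>2)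
      \<le> S\<^sup>2 * (2 * (\<Sum>n=N k..<N (Suc k). (U x n)\<^sup>2) + 2 * (S\<^sup>2 * \<epsilon>\<^sup>2 * (err k + err (Suc k))))" for k
  proof -
    have "(\<Sum>j<N (Suc k). (xs (Suc k) j - xs k j)\<^sup>2)
        \<le> S\<^sup>2 * (\<Sum>n<N (Suc k). (U (\<lambda>j. xs (Suc k) j - xs k j) n)\<^sup>2)"
      by (rule U_ge_finite) (use supp Ndiff[of k] in auto)
    also have "\<dots> \<le> S\<^sup>2 * (\<Sum>n<N (Suc k). 2 * (r k n)\<^sup>2 + 2 * (r (Suc k) n)\<^sup>2)"
    proof (intro mult_left_mono sum_mono)
      fix n
      have "U (\<lambda>j. xs (Suc k) j - xs k j) n = r k n - r (Suc k) n"
        unfolding r_def U_diff[OF l2_xs l2_xs] by simp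
      then show "(U (\<lambda>j. xs (Suc k) j - xs k j) n)\<^sup>2 \<le> 2 * (r k n)\<^sup>2 + 2 * (r (Suc k) n)\<^sup>2"
        using zero_le_power2[of "r k n + r (Suc k) n"] by (simp add: power2_sum power2_diff)
    qed simp
    also have "(\<Sum>n<N (Suc k). 2 * (r k n)\<^sup>2 + 2 * (r (Suc k) n)\<^sup>2)
        = 2 * (\<Sum>n<N (Suc k). (r k n)\<^sup>2) + 2 * (\<Sum>n<N (Suc k). (r (Suc k) n)\<^sup>2)"
      by (simp add: sum.distrib sum_distrib_left)
    also have "(\<Sum>n<N (Suc k). (r k n)\<^sup>2)
        = (\<Sum>n<N k. (r k n)\<^sup>2) + (\<Sum>n=N k..<N (Suc k). (r k n)\<^sup>2)"
      using sum.atLeastLessThan_concat[of 0 "N k" "N (Suc k)" "\<lambda>n. (r k n)\<^sup>2"] Ndiff[of k]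
      by (simp add: atLeast0LessThan)
    also have "(\<Sum>n=N k..<N (Suc k). (r k n)\<^sup>2) = (\<Sum>n=N k..<N (Suc k). (U x n)\<^sup>2)"
      using r_tail by simp
    finally show ?thesis
    proof (rule order_trans, intro mult_left_mono)
      show "2 * ((\<Sum>n<N k. (r k n)\<^sup>2) + (\<Sum>n=N k..<N (Suc k). (U x n)\<^sup>2)) + 2 * (\<Sum>n<N (Suc k). (r (Suc k) n)\<^sup>2)
          \<le> 2 * (\<Sum>n=N k..<N (Suc k). (U x n)\<^sup>2) + 2 * (S\<^sup>2 * \<epsilon>\<^sup>2 * (err k + err (Suc k)))"
        using r_small[of k] r_small[of "Suc k"] by (simp add: algebra_simps)
    qed simp
  qed
  have telescope: "(\<Sum>k=l..l+n. \<Sum>i=N k..<N (Suc k). (U x i)\<^sup>2) = (\<Sum>i=N l..<N (Suc (l+n)). (U x i)\<^sup>2)"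
  proof (induction n)
    case (Suc n)
    have "N l \<le> N (Suc (l + n))"
      using N by (simp add: monoD)
    then show ?case
      using Suc Ndiff by (simp add: sum.atLeastLessThan_concat)
  qed simp
  \<comment> \<open>Beyond \<open>N l\<close> the image \<open>U x\<close> coincides with
    \<open>r l\<close>, so the whole tail is controlled by the error at level \<open>l\<close>
    rather than by the norm of \<open>x\<close>.\<close>
  have "(\<Sum>i=N l..<N (Suc (l+n)). (U x i)\<^sup>2) = (\<Sum>i=N l..<N (Suc (l+n)). (r l i)\<^sup>2)"
    using r_tail by simp
  also have "\<dots> \<le> (\<Sum>i<N (Suc (l+n)). (r l i)\<^sup>2)"
    by (rule sum_mono2) auto
  also have "\<dots> \<le> S\<^sup>2 * S\<^sup>2 * err l"
    using U_le[OF l2_diff[of l]] unfolding r err_def .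
  finally have tail: "(\<Sum>i=N l..<N (Suc (l+n)). (U x i)\<^sup>2) \<le> S\<^sup>2 * S\<^sup>2 * err l" .
  have "(\<Sum>k=l..l+n. \<Sum>j<N (Suc k). (xs (Suc k) j - xs k j)\<^sup>2)
      \<le> (\<Sum>k=l..l+n. S\<^sup>2 * (2 * (\<Sum>n=N k..<N (Suc k). (U x n)\<^sup>2) + 2 * (S\<^sup>2 * \<epsilon>\<^sup>2 * (err k + err (Suc k)))))"
    by (rule sum_mono[OF step])
  also have "\<dots> = S\<^sup>2 * (2 * (\<Sum>i=N l..<N (Suc (l+n)). (U x i)\<^sup>2)
      + 2 * (S\<^sup>2 * \<epsilon>\<^sup>2 * (\<Sum>k=l..l+n. err k + err (Suc k))))"
    unfolding telescope[symmetric] sum_distrib_left[symmetric] sum.distrib ..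
  also have "\<dots> \<le> S\<^sup>2 * (2 * (S\<^sup>2 * S\<^sup>2 * err l)
      + 2 * (S\<^sup>2 * \<epsilon>\<^sup>2 * (\<Sum>k=l..l+n. err k + err (Suc k))))"
    using tail by (intro mult_left_mono add_right_mono) auto
  also have "\<dots> = 2 * S ^ 6 * err l + 2 * S ^ 4 * \<epsilon>\<^sup>2 * (\<Sum>k=l..l+n. err k + err (Suc k))"
    by (simp add: algebra_simps flip: power_add)
  finally show ?thesis .
qed

end

section \<open>Galerkin approximations: coefficients, Cea's lemma and residuals\<close>

lemma span_image_lessThan_coeffs:
  fixes v :: "nat \<Rightarrow> 'a::real_vector"
  assumes "x \<in> span (v ` {..<m})"
  obtains c where "x = (\<Sum>j<m. c j *\<^sub>R v j)" "\<And>j. m \<le> j \<Longrightarrow> c j = 0"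
proof -
  have "\<exists>c. x = (\<Sum>j<m. c j *\<^sub>R v j)"
    using assms
  proof (induction rule: span_induct_alt)
    case base
    show ?case by (rule exI[of _ "\<lambda>_. 0"]) simp
  next
    case (step t y z)
    then obtain i c where i: "i < m" "y = v i" and z: "z = (\<Sum>j<m. c j *\<^sub>R v j)" by auto
    have "(\<Sum>j<m. (c j + (if j = i then t else 0)) *\<^sub>R v j)
        = z + (\<Sum>j<m. if j = i then t *\<^sub>R v i else 0)"
      unfolding z sum.distrib[symmetric] by (intro sum.cong) (auto simp: scaleR_add_left)
    then have "t *\<^sub>R y + z = (\<Sum>j<m. (c j + (if j = i then t else 0)) *\<^sub>R v j)"
      using i by simp
    then show ?case by (rule exI[of _ "\<lambda>j. c j + (if j = i then t else 0)"])
  qed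
  then obtain c where c: "x = (\<Sum>j<m. c j *\<^sub>R v j)" by blast
  show ?thesis
    by (rule that[of "\<lambda>j. if j < m then c j else 0"]) (simp_all add: c)
qed

text \<open>Galerkin orthogonality replaces \<open>z\<close> by \<open>y\<close> in the second
  argument of \<open>a\<close>. Applied with \<open>y\<close> the previous approximation, it
  compares consecutive errors.\<close>

lemma cea:
  fixes a :: "'a::real_inner \<Rightarrow> 'a \<Rightarrow> real"
  assumes a: "bounded_bilinear a" and \<alpha>: "\<alpha> > 0" "\<And>x. \<alpha> * (norm x)\<^sup>2 \<le> a x x"
    and b: "\<And>x y. norm (a x y) \<le> norm x * norm y * b"
    and orth: "\<And>y. y \<in> X \<Longrightarrow> a (u - z) y = 0" and X: "subspace X" "z \<in> X" "y \<in> X"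
  shows "(norm (u - z))\<^sup>2 \<le> (b / \<alpha>)\<^sup>2 * (norm (u - y))\<^sup>2"
proof (cases "u = z")
  case False
  interpret a: bounded_bilinear a by (rule a)
  have "y - z \<in> X"
    using X by (simp add: subspace_diff)
  then have "a (u - z) (y - z) = 0" by (rule orth)
  then have "a (u - z) (u - z) = a (u - z) (u - y)"
    by (simp add: a.diff_right)
  then have "\<alpha> * (norm (u - z))\<^sup>2 \<le> norm (u - z) * norm (u - y) * b"
    using \<alpha>(2)[of "u - z"] b[of "u - z" "u - y"] by simp
  then have "norm (u - z) * (\<alpha> * norm (u - z)) \<le> norm (u - z) * (norm (u - y) * b)"
    by (simp add: power2_eq_square mult_ac)
  then have "\<alpha> * norm (u - z) \<le> norm (u - y) * b"
    using False by (simp only: mult_le_cancel_left_pos zero_less_norm_iff right_minus_eq not_False_eq_True)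
  then have "norm (u - z) \<le> b / \<alpha> * norm (u - y)"
    using \<alpha>(1) by (simp add: field_simps)
  then have "(norm (u - z))\<^sup>2 \<le> (b / \<alpha> * norm (u - y))\<^sup>2"
    by (rule power_mono) simp
  then show ?thesis by (simp only: power_mult_distrib)
qed simp

text \<open>On the first \<open>m\<close> entries \<open>M x\<close> vanishes, so there
  \<open>A x\<close> equals \<open>-(M - A) x\<close>, which the operator norm bound
  controls.\<close>

lemma residual_le_perturbation:
  assumes op: "op_norm2_le (\<lambda>i j. M i j - A i j) \<epsilon>" and A: "schur_bounded S A" and x: "l2 x"
    and M: "\<And>i. i < m \<Longrightarrow> (\<lambda>j. M i j * x j) sums 0"
  shows "(\<Sum>i<m. (mat_apply A x i)\<^sup>2) \<le> \<epsilon>\<^sup>2 * (\<Sum>j. (x j)\<^sup>2)"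
proof -
  let ?D = "\<lambda>i j. M i j - A i j"
  have D: "l2 (mat_apply ?D x)" "(\<Sum>i. (mat_apply ?D x i)\<^sup>2) \<le> \<epsilon>\<^sup>2 * (\<Sum>j. (x j)\<^sup>2)"
    using op x by (auto simp: op_norm2_le_def)
  have "mat_apply ?D x i = - mat_apply A x i" if "i < m" for i
  proof -
    have "(\<lambda>j. A i j * x j) sums mat_apply A x i"
      unfolding mat_apply_def by (intro summable_sums schur_bounded_mat_apply(1)[OF A x])
    from sums_diff[OF M[OF that] this] show ?thesis
      unfolding mat_apply_def[of ?D] by (simp add: left_diff_distrib sums_unique[symmetric])
  qed
  then have "(\<Sum>i<m. (mat_apply A x i)\<^sup>2) = (\<Sum>i<m. (mat_apply ?D x i)\<^sup>2)"
    by simp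
  also have "\<dots> \<le> (\<Sum>i. (mat_apply ?D x i)\<^sup>2)"
    using D(1) by (intro sum_le_suminf) (auto simp: l2_def)
  finally show ?thesis using D(2) by linarith
qed

theorem theorem3p14:
  fixes a :: "'a::{real_inner,complete_space} \<Rightarrow> 'a \<Rightarrow> real"
    and w :: "nat \<Rightarrow> 'a"
    and C Cell \<gamma> :: real
    and d :: "nat \<Rightarrow> nat \<Rightarrow> real"
    and CJ :: "real \<Rightarrow> real"
  assumes separable: "\<exists>D::'a set. countable D \<and> closure D = UNIV"
    and a_bounded: "bounded_bilinear a"
    and a_coercive: "\<exists>\<alpha>>0. \<forall>x. \<alpha> * (norm x)^2 \<le> a x x"
    and w_riesz: "riesz_basis C w"
    and Cell_pos: "Cell > 0"
    and d_metric: "jaffard_metric d"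
    and \<gamma>_pos: "\<gamma> > 0"
  shows "\<exists>Cqo>0. \<forall>v Nl f u uu \<epsilon> M\<epsilon>.
     riesz_basis C v \<longrightarrow>
     strict_mono Nl \<longrightarrow>
     (\<forall>l. span (w ` {..<Nl l}) = span (v ` {..<Nl l})) \<longrightarrow>
     bounded_linear f \<longrightarrow>
     (\<forall>y. a u y = f y) \<longrightarrow>
     (\<forall>l. uu l \<in> span (w ` {..<Nl l}) \<and> (\<forall>y\<in>span (w ` {..<Nl l}). a (uu l) y = f y)) \<longrightarrow>
     \<epsilon> > 0 \<longrightarrow>
     op_norm2_le (\<lambda>i j. a (v j) (w i) - M\<epsilon> i j) \<epsilon> \<longrightarrow>
     elliptic Cell (\<lambda>i j. a (v j) (w i)) \<longrightarrow>
     elliptic Cell M\<epsilon> \<longrightarrow>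
     jaffard_bound d \<gamma> CJ M\<epsilon> \<longrightarrow>
     (\<forall>l N. (\<Sum>k=l..l+N. (norm (uu (Suc k) - uu k))^2 - Cqo * \<epsilon> * (norm (u - uu k))^2)
              \<le> Cqo * (norm (u - uu l))^2)"
proof -
  obtain \<alpha> where \<alpha>: "\<alpha> > 0" "\<And>x. \<alpha> * (norm x)\<^sup>2 \<le> a x x"
    using a_coercive by blast
  interpret a: bounded_bilinear a by (rule a_bounded)
  obtain b where b: "\<And>x y. norm (a x y) \<le> norm x * norm y * b"
    using a.bounded by blast
  define q where "q = (b / \<alpha>)\<^sup>2"
  have C: "C > 0"
    using w_riesz by (simp add: riesz_basis_def)
  \<comment> \<open>The admissible rate \<open>\<gamma> / 2\<close> is selected from the Jaffard
    class; the absolute value plus 1 makes the constant positive whatever the value of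
    \<open>CJ\<close>.\<close>
  define K where "K = \<bar>CJ (\<gamma> / 2)\<bar> + 1"
  have K: "K > 0" by (simp add: K_def)
  obtain S where "S > 0" and factor:
    "\<forall>A. finitely_elliptic Cell A \<longrightarrow> (\<forall>i j. \<bar>A i j\<bar> \<le> K * exp (- (\<gamma> / 2) * d i j))
      \<longrightarrow> (\<exists>Z Q. triangular_factorization S A Z Q)"
    using triangular_factorization_exists[OF d_metric half_gt_zero[OF \<gamma>_pos] Cell_pos K]
    by (elim exE conjE)
  \<comment> \<open>\<open>c1\<close> and \<open>c2\<close> serve the case of \<epsilon> at most 1,
    with \<open>C\<^sup>2\<close> from passing to coefficients and back and \<open>q\<close> from
    Cea's lemma; \<open>c3\<close> serves larger \<epsilon>. All are fixed before \<open>v\<close>,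
    \<open>Nl\<close>, \<open>f\<close> and the matrix.\<close>
  define c1 where "c1 = 2 * C\<^sup>2 * S ^ 6"
  define c2 where "c2 = 2 * C\<^sup>2 * S ^ 4 * (1 + q)"
  define c3 where "c3 = 2 * (1 + q)"
  have q: "q \<ge> 0" by (simp add: q_def)
  have c: "c1 \<ge> 0" "c2 \<ge> 0" "c3 > 0"
    using C \<open>S > 0\<close> q by (simp_all add: c1_def c2_def c3_def)
  show ?thesis
  proof (intro exI[of _ "c1 + c2 + c3"] conjI allI impI)
    show "c1 + c2 + c3 > 0" using c by simp
  next
    fix v :: "nat \<Rightarrow> 'a" and Nl :: "nat \<Rightarrow> nat" and f :: "'a \<Rightarrow> real" and u :: 'a
      and uu :: "nat \<Rightarrow> 'a" and \<epsilon> :: real and A :: "nat \<Rightarrow> nat \<Rightarrow> real" and l N :: nat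
    assume v: "riesz_basis C v" and Nl: "strict_mono Nl"
      and spans: "\<forall>l. span (w ` {..<Nl l}) = span (v ` {..<Nl l})"
      and "bounded_linear f" and u: "\<forall>y. a u y = f y"
      and uu: "\<forall>l. uu l \<in> span (w ` {..<Nl l}) \<and> (\<forall>y\<in>span (w ` {..<Nl l}). a (uu l) y = f y)"
      and \<epsilon>: "\<epsilon> > 0" and op: "op_norm2_le (\<lambda>i j. a (v j) (w i) - A i j) \<epsilon>"
      and "elliptic Cell (\<lambda>i j. a (v j) (w i))" and ell: "elliptic Cell A"
      and jaff: "jaffard_bound d \<gamma> CJ A"
    define E where "E k = (norm (u - uu k))\<^sup>2" for k
    define G where "G k = (norm (uu (Suc k) - uu k))\<^sup>2" for k
    have orth: "a (u - uu k) y = 0" if "y \<in> span (w ` {..<Nl k})" for k y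
      using that u uu by (simp add: a.diff_left)
    have E0: "E k \<ge> 0" for k
      by (simp add: E_def)
    have E_Suc: "E (Suc k) \<le> q * E k" for k
    proof -
      have "w ` {..<Nl k} \<subseteq> w ` {..<Nl (Suc k)}"
        using strict_monoD[OF Nl, of k "Suc k"] by (intro image_mono) auto
      then have "uu k \<in> span (w ` {..<Nl (Suc k)})"
        using uu span_mono by blast
      then show ?thesis
        unfolding E_def q_def
        using cea[OF a_bounded \<alpha> b orth[of _ "Suc k"] subspace_span] uu by blast
    qed
    have sum_main: "(\<Sum>k=l..l+N. G k) \<le> (c1 + c2 + c3) * E l + (c1 + c2 + c3) * \<epsilon> * (\<Sum>k=l..l+N. E k)"
    proof (cases "\<epsilon> \<le> 1")
      case False
      \<comment> \<open>For \<epsilon> above 1 each increment is estimated separately, by the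
        triangle inequality and Cea's lemma.\<close>
      have "G k \<le> (c1 + c2 + c3) * \<epsilon> * E k" for k
      proof -
        have "G k = (norm ((u - uu k) - (u - uu (Suc k))))\<^sup>2"
          by (simp add: G_def)
        also have "\<dots> \<le> (norm (u - uu k) + norm (u - uu (Suc k)))\<^sup>2"
          by (intro power_mono norm_triangle_ineq4) simp
        also have "\<dots> \<le> 2 * E k + 2 * E (Suc k)"
          unfolding E_def using sum_squares_bound[of "norm (u - uu k)" "norm (u - uu (Suc k))"]
          by (simp add: power2_sum)
        also have "\<dots> \<le> c3 * E k"
          using E_Suc[of k] by (simp add: c3_def algebra_simps)
        also have "\<dots> \<le> (c1 + c2 + c3) * \<epsilon> * E k"
        proof (rule mult_right_mono[OF _ E0])
          have "c3 * 1 \<le> (c1 + c2 + c3) * \<epsilon>"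
            using c False by (intro mult_mono) auto
          then show "c3 \<le> (c1 + c2 + c3) * \<epsilon>" by simp
        qed
        finally show ?thesis .
      qed
      then have "(\<Sum>k=l..l+N. G k) \<le> (c1 + c2 + c3) * \<epsilon> * (\<Sum>k=l..l+N. E k)"
        unfolding sum_distrib_left by (rule sum_mono)
      moreover have "(c1 + c2 + c3) * E l \<ge> 0"
        using c E0 by simp
      ultimately show ?thesis by linarith
    next
      case True
      have "\<bar>A i j\<bar> \<le> K * exp (- (\<gamma> / 2) * d i j)" for i j
      proof -
        have "\<bar>A i j\<bar> \<le> CJ (\<gamma> / 2) * exp (- (\<gamma> / 2) * d i j)"
          using \<gamma>_pos by (intro jaff[unfolded jaffard_bound_def, rule_format]) simp
        also have "\<dots> \<le> K * exp (- (\<gamma> / 2) * d i j)"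
          by (rule mult_right_mono) (auto simp: K_def)
        finally show ?thesis .
      qed
      then obtain Z Q where "triangular_factorization S A Z Q"
        using factor elliptic_imp_finitely_elliptic[OF ell] by blast
      then interpret triangular_factorization S A Z Q .
      obtain x where x: "l2 x" "(\<lambda>n. x n *\<^sub>R v n) sums u"
        using v unfolding riesz_basis_def by blast
      \<comment> \<open>Equality of the spans turns membership in the span of the \<open>w\<close>
        vectors into coefficients with respect to \<open>v\<close>, extended by zero.\<close>
      have "\<exists>c. uu k = (\<Sum>j<Nl k. c j *\<^sub>R v j) \<and> (\<forall>j\<ge>Nl k. c j = 0)" for k
        using span_image_lessThan_coeffs[of "uu k" v "Nl k"] uu spans by metis
      then obtain xs where xs: "\<And>k. uu k = (\<Sum>j<Nl k. xs k j *\<^sub>R v j)" "\<And>k j. Nl k \<le> j \<Longrightarrow> xs k j = 0"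
        by metis
      have xs_sums: "(\<lambda>j. xs k j *\<^sub>R v j) sums uu k" for k
        unfolding xs(1)[of k] by (rule sums_finite) (use xs(2) in auto)
      have diff_sums: "(\<lambda>j. (x j - xs k j) *\<^sub>R v j) sums (u - uu k)" for k
        using sums_diff[OF x(2) xs_sums] by (simp add: scaleR_left_diff_distrib)
      have l2_diff: "l2 (\<lambda>j. x j - xs k j)" for k
        by (rule l2_diff[OF x(1) l2_finite]) (rule xs(2))
      define err where "err k = (\<Sum>j. (x j - xs k j)\<^sup>2)" for k
      have riesz: "(norm y)\<^sup>2 / C \<le> (\<Sum>n. (\<mu> n)\<^sup>2)" "(\<Sum>n. (\<mu> n)\<^sup>2) \<le> C * (norm y)\<^sup>2"
        if "l2 \<mu>" "(\<lambda>n. \<mu> n *\<^sub>R v n) sums y" for \<mu> y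
        using v that unfolding riesz_basis_def by blast+
      have err_le: "err k \<le> C * E k" for k
        unfolding err_def E_def by (rule riesz(2)[OF l2_diff diff_sums])
      \<comment> \<open>Row \<open>i\<close> of the Galerkin matrix applied to the error
        coefficients is \<open>a (u - uu k) (w i)\<close>, by continuity of \<open>a\<close>; it
        vanishes by orthogonality for \<open>i < Nl k\<close>.\<close>
      have res: "(\<Sum>i<Nl k. (mat_apply A (\<lambda>j. x j - xs k j) i)\<^sup>2) \<le> \<epsilon>\<^sup>2 * (\<Sum>j. (x j - xs k j)\<^sup>2)" for k
      proof (rule residual_le_perturbation[OF op A_bounded l2_diff])
        fix i assume "i < Nl k"
        then have "a (u - uu k) (w i) = 0"
          by (intro orth span_base) auto
        then show "(\<lambda>j. a (v j) (w i) * (x j - xs k j)) sums 0"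
          using bounded_linear.sums[OF a.bounded_linear_left[of "w i"] diff_sums[of k]]
          by (simp add: a.scaleR_left mult.commute)
      qed
      have G_le: "G k \<le> C * (\<Sum>j<Nl (Suc k). (xs (Suc k) j - xs k j)\<^sup>2)" for k
      proof -
        have z: "xs (Suc k) j - xs k j = 0" if "Nl (Suc k) \<le> j" for j
          using that xs(2) strict_monoD[OF Nl, of k "Suc k"] by simp
        have "(\<lambda>j. (xs (Suc k) j - xs k j) *\<^sub>R v j) sums (uu (Suc k) - uu k)"
          using sums_diff[OF xs_sums xs_sums] by (simp add: scaleR_left_diff_distrib)
        then have "G k / C \<le> (\<Sum>j. (xs (Suc k) j - xs k j)\<^sup>2)"
          unfolding G_def by (intro riesz(1) l2_finite[of "Nl (Suc k)"] z)
        also have "\<dots> = (\<Sum>j<Nl (Suc k). (xs (Suc k) j - xs k j)\<^sup>2)"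
          by (rule suminf_finite) (use z in auto)
        finally show ?thesis using C by (simp add: field_simps)
      qed
      have "(\<Sum>k=l..l+N. G k) \<le> C * (\<Sum>k=l..l+N. \<Sum>j<Nl (Suc k). (xs (Suc k) j - xs k j)\<^sup>2)"
        unfolding sum_distrib_left[of C "\<lambda>k. \<Sum>j<Nl (Suc k). _ k j"] by (rule sum_mono[OF G_le])
      also have "\<dots> \<le> C * (2 * S ^ 6 * err l + 2 * S ^ 4 * \<epsilon>\<^sup>2 * (\<Sum>k=l..l+N. err k + err (Suc k)))"
        unfolding err_def
        by (intro mult_left_mono quasi_orthogonality[OF x(1) strict_mono_mono[OF Nl] xs(2) res])
          (use C in auto)
      \<comment> \<open>Here \<open>\<epsilon>\<^sup>2\<close> is weakened to \<epsilon>,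
        coefficient errors return to norms, and Cea's lemma absorbs the error at level
        \<open>Suc k\<close> into that at level \<open>k\<close>.\<close>
      also have "\<dots> \<le> C * (2 * S ^ 6 * (C * E l) + 2 * S ^ 4 * \<epsilon> * (\<Sum>k=l..l+N. C * (1 + q) * E k))"
      proof (intro mult_left_mono add_mono mult_mono sum_mono err_le)
        show "\<epsilon>\<^sup>2 \<le> \<epsilon>"
          using \<epsilon> True by (simp add: power2_eq_square mult_left_le)
        show "err k + err (Suc k) \<le> C * (1 + q) * E k" for k
        proof -
          have "err (Suc k) \<le> C * (q * E k)"
            by (rule order_trans[OF err_le mult_left_mono[OF E_Suc]]) (use C in simp)
          then show ?thesis
            using err_le[of k] by (simp add: algebra_simps)
        qed
        show "0 \<le> (\<Sum>k=l..l+N. err k + err (Suc k))"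
          by (intro sum_nonneg add_nonneg_nonneg) (auto simp: err_def suminf_nonneg l2_diff[unfolded l2_def])
      qed (use C \<epsilon> \<open>S > 0\<close> in auto)
      also have "\<dots> = c1 * E l + c2 * \<epsilon> * (\<Sum>k=l..l+N. E k)"
        unfolding c1_def c2_def sum_distrib_left[symmetric] by (simp add: algebra_simps power2_eq_square)
      also have "\<dots> \<le> (c1 + c2 + c3) * E l + (c1 + c2 + c3) * \<epsilon> * (\<Sum>k=l..l+N. E k)"
        using c \<epsilon> by (intro add_mono mult_right_mono sum_nonneg E0) auto
      finally show ?thesis .
    qed
    show "(\<Sum>k=l..l+N. (norm (uu (Suc k) - uu k))\<^sup>2 - (c1 + c2 + c3) * \<epsilon> * (norm (u - uu k))\<^sup>2)
        \<le> (c1 + c2 + c3) * (norm (u - uu l))\<^sup>2"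
      using sum_main unfolding sum_subtractf sum_distrib_left[symmetric] E_def G_def by linarith
  qed
qed

end
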